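(* First half-time slot ($d_1$ transmits to $d_2$ with power $P_1$, the cellular user $u$ transmits to the base station $b$ with power $P_u$). Consider the problem of maximizing $$R_{d_2}=B\log_2\Big(1+\frac{P_1h_d}{P_uh_{d_2,u}+\sigma^2}\Big)$$ over the transmit powers $(P_1,P_u)$ subject to $P_1\le P_{1,M}$, $P_u\le P_{u,M}$ and $$R_{u,1}=B\log_2\Big(1+\frac{P_uh_{b,u}}{P_1h_{b,d_1}+\sigma^2}\Big)\ge R_{u,min}.$$ Let $P_u=f(P_1)$ be the function obtained by enforcing the equality $R_{u,1}=R_{u,min}$, i.e. $f(P_1)=(2^{R_{u,min}/B}-1)(P_1h_{b,d_1}+\sigma^2)/h_{b,u}$. If $f(P_{1,M})\le P_{u,M}$, then $(P_1,P_u)=(P_{1,M},f(P_{1,M}))$ is the solution; otherwise $(P_1,P_u)=(f^{-1}(P_{u,M}),P_{u,M})$ is the best solution. Second half-time slot ($d_2$ transmits to $d_1$, and $P_1=0$): the same reasoning, with the roles of $d_1$ and $d_2$ exchanged, gives the powers maximizing the rate $R_{d_1}$ of $d_1$. The total rates over the slot are $R_{D2D}=\tfrac12R_{d_1}+\tfrac12R_{d_2}$ for the D2D pair and $R_u=\tfrac12R_{u,1}+\tfrac12R_{u,2}$ for $u$, where $R_{u,2}$ is the rate of $u$ in the second half.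
   Context: This is half-duplex device-to-device (D2D) power allocation without interference cancellation. Two devices $d_1,d_2$ share the uplink channel of a cellular user $u$ served by a base station $b$. The time slot is split into two equal halves, in which $d_1$ and $d_2$ alternately transmit to each other, and the optimization is conducted separately in the two halves. The positive numbers $h_d,h_{b,u},h_{b,d_j},h_{d_j,u}$ are the channel gains of the links $d_1$–$d_2$, $u$–$b$, $d_j$–$b$ and $u$–$d_j$; $\sigma^2$ is the noise power, $B$ the channel bandwidth, $R_{u,min}$ the target rate of $u$, and $P_{1,M},P_{2,M},P_{u,M}$ the maximum transmit powers of $d_1,d_2,u$.
   Formalization: In the "otherwise" case of each half-slot, it is additionally assumed that some pair of nonnegative powers within the maximum powers meets the target rate; without this, f^{-1}(P_{u,M}) is negative and no solution exists. *)

theory Defs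
  imports "HOL-Analysis.Analysis"
begin

text \<open>
  In each half of the slot exactly one device transmits. Everything below is stated for that
  half-slot with transmit power \<open>P\<close> of the active device and transmit power \<open>Pu\<close> of the cellular
  user; the silent device has power 0 and contributes no interference. The parameters are
  the bandwidth \<open>B\<close>, the noise power \<open>N\<close>, the gain \<open>hdd\<close> between the devices, the gain \<open>hru\<close> from
  the cellular user to the receiving device, the gain \<open>hbu\<close> from the cellular user to the base
  station and the gain \<open>hbd\<close> from the transmitting device to the base station.
\<close>

definition d2d_rate :: "real \<Rightarrow> real \<Rightarrow> real \<Rightarrow> real \<Rightarrow> real \<times> real \<Rightarrow> real" where
  "d2d_rate B N hdd hru = (\<lambda>(P, Pu). B * log 2 (1 + P * hdd / (Pu * hru + N)))"

definition cu_rate :: "real \<Rightarrow> real \<Rightarrow> real \<Rightarrow> real \<Rightarrow> real \<times> real \<Rightarrow> real" where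
  "cu_rate B N hbu hbd = (\<lambda>(P, Pu). B * log 2 (1 + Pu * hbu / (P * hbd + N)))"

text \<open>Transmit powers are physical powers, hence nonnegative.\<close>

definition feasible ::
  "real \<Rightarrow> real \<Rightarrow> real \<Rightarrow> real \<Rightarrow> real \<Rightarrow> real \<Rightarrow> real \<Rightarrow> real \<times> real \<Rightarrow> bool" where
  "feasible B N hbu hbd Rmin PM PuM = (\<lambda>(P, Pu).
     0 \<le> P \<and> P \<le> PM \<and> 0 \<le> Pu \<and> Pu \<le> PuM \<and> cu_rate B N hbu hbd (P, Pu) \<ge> Rmin)"

definition cu_power :: "real \<Rightarrow> real \<Rightarrow> real \<Rightarrow> real \<Rightarrow> real \<Rightarrow> real \<Rightarrow> real" where
  "cu_power B N hbu hbd Rmin P = (2 powr (Rmin / B) - 1) * (P * hbd + N) / hbu"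

text \<open>
  The total rate over a slot of length \<open>T\<close> is the time average of the instantaneous rate, which
  is \<open>r1\<close> throughout the first half of the slot and \<open>r2\<close> throughout the second half.
\<close>

definition slot_rate :: "real \<Rightarrow> real \<Rightarrow> real \<Rightarrow> real" where
  "slot_rate T r1 r2 = integral {0..T} (\<lambda>t. if t < T / 2 then r1 else r2) / T"

end

theory Submission
  imports Defs
begin

text \<open>
  For fixed \<open>P\<close> the objective decreases in \<open>Pu\<close>, so the rate constraint should be tight,
  \<open>Pu = f P\<close>. As \<open>f\<close> is affine with nonnegative coefficients, the signal-to-noise ratio along this
  curve has the form \<open>P * hdd / (a * P + b)\<close> with \<open>a \<ge> 0\<close>, \<open>b > 0\<close>, which is strictly increasing;
  hence the optimum is the largest feasible \<open>P\<close>.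
\<close>

text \<open>One half of the slot with anonymous roles: interpreting it twice, with the gains and
  power limits of the two devices exchanged, covers both halves. \<open>N\<close> is the noise
  power.\<close>

locale half_slot =
  fixes B N hdd hru hbu hbd Rmin PM PuM :: real
  assumes B_pos: "B > 0" and N_pos: "N > 0" and hdd_pos: "hdd > 0" and hru_pos: "hru > 0"
    and hbu_pos: "hbu > 0" and hbd_pos: "hbd > 0" and Rmin_nonneg: "Rmin \<ge> 0"
    and PM_pos: "PM > 0"
begin

abbreviation "f \<equiv> cu_power B N hbu hbd Rmin"
abbreviation "feas \<equiv> feasible B N hbu hbd Rmin PM PuM"
abbreviation "rate \<equiv> d2d_rate B N hdd hru"

definition slope :: real where
  "slope = (2 powr (Rmin / B) - 1) * hbd / hbu"

definition offset :: real where
  "offset = (2 powr (Rmin / B) - 1) * N / hbu"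

lemma f_affine: "f P = slope * P + offset"
  using hbu_pos by (simp add: cu_power_def slope_def offset_def field_simps)

lemma slope_nonneg: "slope \<ge> 0" and offset_nonneg: "offset \<ge> 0"
proof -
  have "2 powr (Rmin / B) \<ge> 1"
    using B_pos Rmin_nonneg by (simp add: ge_one_powr_ge_zero)
  then show "slope \<ge> 0" "offset \<ge> 0"
    using N_pos hbu_pos hbd_pos by (simp_all add: slope_def offset_def)
qed

lemma f_nonneg: "P \<ge> 0 \<Longrightarrow> f P \<ge> 0"
  using slope_nonneg offset_nonneg by (simp add: f_affine)

text \<open>The logarithm is strictly increasing and the denominator \<open>D\<close> is positive,
  so both the inequality and the equality on rates can be solved for \<open>Pu\<close>.\<close>

lemma
  assumes "P \<ge> 0" and "Pu \<ge> 0"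
  shows cu_rate_ge_iff: "cu_rate B N hbu hbd (P, Pu) \<ge> Rmin \<longleftrightarrow> Pu \<ge> f P"
    and cu_rate_eq_iff: "cu_rate B N hbu hbd (P, Pu) = Rmin \<longleftrightarrow> Pu = f P"
proof -
  define D where "D = P * hbd + N"
  define s where "s = Pu * hbu / D"
  have D: "D > 0"
    using assms N_pos hbd_pos by (simp add: D_def add_nonneg_pos)
  have s: "1 + s > 0"
    using assms hbu_pos D by (simp add: s_def add_pos_nonneg)
  have rate: "cu_rate B N hbu hbd (P, Pu) = B * log 2 (1 + s)"
    by (simp add: cu_rate_def s_def D_def)
  have f: "f P = (2 powr (Rmin / B) - 1) * D / hbu"
    by (simp add: cu_power_def D_def)
  have "Rmin \<le> B * log 2 (1 + s) \<longleftrightarrow> Rmin / B \<le> log 2 (1 + s)"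
    using B_pos by (simp add: pos_divide_le_eq mult.commute)
  also have "\<dots> \<longleftrightarrow> 2 powr (Rmin / B) \<le> 1 + s"
    using s by (simp add: le_log_iff)
  also have "\<dots> \<longleftrightarrow> f P \<le> Pu"
    using D hbu_pos by (simp add: f s_def field_simps)
  finally show "cu_rate B N hbu hbd (P, Pu) \<ge> Rmin \<longleftrightarrow> Pu \<ge> f P"
    by (simp add: rate)
  have "B * log 2 (1 + s) = Rmin \<longleftrightarrow> log 2 (1 + s) = Rmin / B"
    using B_pos by (auto simp: field_simps)
  also have "\<dots> \<longleftrightarrow> 2 powr (Rmin / B) = 1 + s"
    using s log_powr_cancel[of 2 "Rmin / B"] powr_log_cancel[of 2 "1 + s"] by fastforce
  also have "\<dots> \<longleftrightarrow> Pu = f P"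
    using D hbu_pos by (auto simp: f s_def field_simps)
  finally show "cu_rate B N hbu hbd (P, Pu) = Rmin \<longleftrightarrow> Pu = f P"
    by (simp add: rate)
qed

text \<open>The bound \<open>0 \<le> Pu\<close> disappears because it follows from
  \<open>f P \<le> Pu\<close>.\<close>

lemma feas_iff: "feas (P, Pu) \<longleftrightarrow> 0 \<le> P \<and> P \<le> PM \<and> f P \<le> Pu \<and> Pu \<le> PuM"
  using f_nonneg[of P] cu_rate_ge_iff[of P Pu] unfolding feasible_def by auto

text \<open>Two improvements are combined: lowering \<open>Pu\<close> to the curve, then moving
  along the curve up to \<open>Q\<close>. Positivity of \<open>Q\<close> makes the first one strict
  when \<open>P = Q\<close>; with zero device power the rate is zero whatever \<open>Pu\<close>
  is.\<close>

lemma rate_less: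
  assumes "0 \<le> P" and "P \<le> Q" and "0 < Q" and "f P \<le> Pu" and "(P, Pu) \<noteq> (Q, f Q)"
  shows "rate (P, Pu) < rate (Q, f Q)"
proof -
  have Pu: "0 \<le> Pu" and fQ: "0 \<le> f Q"
    using f_nonneg[of P] f_nonneg[of Q] assms by auto
  have pos: "Pu * hru + N > 0" "f Q * hru + N > 0"
    using Pu fQ hru_pos N_pos by (simp_all add: add_nonneg_pos)
  \<comment> \<open>Cross-multiplied comparison of the two ratios. The slope terms cancel, since
    \<open>Q * f P - P * f Q = (Q - P) * offset\<close>.\<close>
  have "Q * (Pu * hru + N) - P * (f Q * hru + N)
      = (Q - P) * (offset * hru + N) + Q * hru * (Pu - f P)"
    by (simp add: f_affine algebra_simps)
  moreover have "(Q - P) * (offset * hru + N) + Q * hru * (Pu - f P) > 0"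
  proof (cases "P = Q")
    case True
    then show ?thesis
      using assms hru_pos by simp
  next
    case False
    then have "(Q - P) * (offset * hru + N) > 0"
      using assms offset_nonneg hru_pos N_pos by (simp add: add_nonneg_pos)
    moreover have "Q * hru * (Pu - f P) \<ge> 0"
      using assms hru_pos by simp
    ultimately show ?thesis
      by linarith
  qed
  ultimately have "P / (Pu * hru + N) < Q / (f Q * hru + N)"
    using pos by (simp add: divide_less_eq less_divide_eq mult.commute)
  then have "P * hdd / (Pu * hru + N) < Q * hdd / (f Q * hru + N)"
    using hdd_pos by (metis mult_strict_right_mono times_divide_eq_left)
  \<comment> \<open>Keeps the argument of the logarithm positive, where it is strictly
    monotone.\<close>
  moreover have "0 \<le> P * hdd / (Pu * hru + N)"
    using assms hdd_pos pos by simp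
  ultimately show ?thesis
    using B_pos by (simp add: d2d_rate_def)
qed

text \<open>Every other feasible point is strictly worse by \<open>rate_less\<close> if
  \<open>0 < Q\<close>. If \<open>Q = 0\<close>, all feasible points have rate zero, and uniqueness
  comes instead from \<open>f Q = PuM\<close>, which leaves only one feasible point.\<close>

lemma arg_max_eq:
  assumes "feas (Q, f Q)" and max: "\<And>P Pu. feas (P, Pu) \<Longrightarrow> P \<le> Q" and "0 < Q \<or> f Q = PuM"
  shows "{p. is_arg_max rate feas p} = {(Q, f Q)}"
proof -
  have less: "rate p < rate (Q, f Q)" if "feas p" "p \<noteq> (Q, f Q)" for p
  proof -
    obtain P Pu where p: "p = (P, Pu)"
      by (cases p)
    have PQ: "0 \<le> P" "P \<le> Q" "f P \<le> Pu" "Pu \<le> PuM"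
      using that max unfolding p feas_iff by auto
    have "Q \<noteq> 0"
    proof
      assume "Q = 0"
      then have "P = Q" "Pu = f Q"
        using PQ assms(3) by auto
      then show False
        using that p by simp
    qed
    then show ?thesis
      using rate_less[of P Q Pu] PQ that p by simp
  qed
  then show ?thesis
    using assms(1) unfolding is_arg_max_def by (auto dest: less_asym) (metis less)+
qed

lemma arg_max_device_limited:
  assumes "f PM \<le> PuM"
  shows "{p. is_arg_max rate feas p} = {(PM, f PM)}"
  using assms PM_pos by (intro arg_max_eq) (auto simp: feas_iff)

text \<open>The largest feasible device power is where the increasing curve \<open>f\<close> meets
  the cap \<open>PuM\<close>. A feasible point guarantees that this happens at a nonnegative
  power.\<close>

lemma arg_max_user_limited:
  assumes "\<not> f PM \<le> PuM" and "\<exists>p. feas p"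
  shows "bij f \<and> {p. is_arg_max rate feas p} = {(inv f PuM, PuM)}"
proof -
  have "slope \<noteq> 0"
  proof
    assume "slope = 0"
    then have "f P = f PM" for P
      \<comment> \<open>A constant \<open>f\<close> would carry the bound
        \<open>f P \<le> PuM\<close> from a feasible point over to \<open>PM\<close>.\<close>
      by (simp add: f_affine)
    then show False
      using assms by (metis feas_iff order_trans surj_pair)
  qed
  then have slope: "slope > 0"
    using slope_nonneg by simp
  have less: "f P < f Q \<longleftrightarrow> P < Q" for P Q
    using slope by (simp add: f_affine)
  have bij: "bij f"
  proof (rule bijI)
    show "inj f"
      using less by (metis injI linorder_neq_iff)
    show "surj f"
      using slope by (intro surjI[of _ "\<lambda>y. (y - offset) / slope"]) (simp add: f_affine)
  qed
  define Q where "Q = inv f PuM"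
  have fQ: "f Q = PuM"
    using bij by (simp add: Q_def bij_is_surj surj_f_inv_f)
  have max: "P \<le> Q" if "feas (P, Pu)" for P Pu
    using that less[of Q P] unfolding feas_iff fQ by linarith
  have "0 \<le> Q"
    using assms(2) max by (metis feas_iff order_trans surj_pair)
  moreover have "Q \<le> PM"
    using assms(1) less[of Q PM] fQ by simp
  ultimately have "feas (Q, f Q)"
    by (simp add: feas_iff fQ)
  then have "{p. is_arg_max rate feas p} = {(Q, f Q)}"
    \<comment> \<open>\<open>Q = 0\<close> is possible here, so the alternative
      \<open>f Q = PuM\<close> is the one used.\<close>
    using max fQ by (intro arg_max_eq) auto
  then show ?thesis
    using bij fQ by (simp add: Q_def)
qed

end

lemma slot_rate_eq:
  assumes "T > 0"
  shows "slot_rate T r1 r2 = 1/2 * r1 + 1/2 * r2"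
proof -
  let ?r = "\<lambda>t. if t < T / 2 then r1 else r2"
  \<comment> \<open>The integrand already equals \<open>r2\<close> at \<open>T / 2\<close>, so on
    the closed first half it agrees with \<open>r1\<close> only up to that one point.\<close>
  have "(?r has_integral (T / 2 * r1)) {0..T / 2}"
    by (rule has_integral_spike_finite[of "{T / 2}" _ _ "\<lambda>_. r1"])
      (use assms has_integral_const_real[of r1 0 "T / 2"] in auto)
  moreover have "(?r has_integral (T / 2 * r2)) {T / 2..T}"
    by (rule has_integral_eq[of _ "\<lambda>_. r2"])
      (use assms has_integral_const_real[of r2 "T / 2" T] in auto)
  ultimately have "(?r has_integral (T / 2 * r1 + T / 2 * r2)) {0..T}"
    using assms by (intro has_integral_combine[of 0 "T / 2"]) auto
  then show ?thesis
    using assms by (simp add: slot_rate_def integral_unique field_simps)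
qed

theorem mainTheorem7:
  fixes B \<sigma> h_d h_bu h_bd1 h_bd2 h_d1u h_d2u R_min P1M P2M PuM T :: real
  assumes "B > 0" and "\<sigma> > 0" and "h_d > 0" and "h_bu > 0"
    and "h_bd1 > 0" and "h_bd2 > 0" and "h_d1u > 0" and "h_d2u > 0"
    and "R_min \<ge> 0" and "P1M > 0" and "P2M > 0" and "PuM > 0" and "T > 0"
  shows
    "let R_d2 = d2d_rate B (\<sigma>\<^sup>2) h_d h_d2u;
         R_u1 = cu_rate B (\<sigma>\<^sup>2) h_bu h_bd1;
         feas1 = feasible B (\<sigma>\<^sup>2) h_bu h_bd1 R_min P1M PuM;
         f1 = cu_power B (\<sigma>\<^sup>2) h_bu h_bd1 R_min;
         R_d1 = d2d_rate B (\<sigma>\<^sup>2) h_d h_d1u;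
         R_u2 = cu_rate B (\<sigma>\<^sup>2) h_bu h_bd2;
         feas2 = feasible B (\<sigma>\<^sup>2) h_bu h_bd2 R_min P2M PuM;
         f2 = cu_power B (\<sigma>\<^sup>2) h_bu h_bd2 R_min
     in
       (\<forall>P1\<ge>0. \<forall>Pu\<ge>0. R_u1 (P1, Pu) = R_min \<longleftrightarrow> Pu = f1 P1) \<and>
       (f1 P1M \<le> PuM \<longrightarrow> {p. is_arg_max R_d2 feas1 p} = {(P1M, f1 P1M)}) \<and>
       (\<not> f1 P1M \<le> PuM \<and> (\<exists>p. feas1 p) \<longrightarrow>
          bij f1 \<and> {p. is_arg_max R_d2 feas1 p} = {(inv f1 PuM, PuM)}) \<and>
       (\<forall>P2\<ge>0. \<forall>Pu\<ge>0. R_u2 (P2, Pu) = R_min \<longleftrightarrow> Pu = f2 P2) \<and>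
       (f2 P2M \<le> PuM \<longrightarrow> {p. is_arg_max R_d1 feas2 p} = {(P2M, f2 P2M)}) \<and>
       (\<not> f2 P2M \<le> PuM \<and> (\<exists>p. feas2 p) \<longrightarrow>
          bij f2 \<and> {p. is_arg_max R_d1 feas2 p} = {(inv f2 PuM, PuM)}) \<and>
       (\<forall>p q. slot_rate T (R_d2 p) (R_d1 q) = 1/2 * R_d1 q + 1/2 * R_d2 p \<and>
              slot_rate T (R_u1 p) (R_u2 q) = 1/2 * R_u1 p + 1/2 * R_u2 q)"
proof -
  interpret first: half_slot B "\<sigma>\<^sup>2" h_d h_d2u h_bu h_bd1 R_min P1M PuM
    using assms by unfold_locales auto
  interpret second: half_slot B "\<sigma>\<^sup>2" h_d h_d1u h_bu h_bd2 R_min P2M PuM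
    using assms by unfold_locales auto
  show ?thesis
    unfolding Let_def
    by (intro conjI allI impI; (elim conjE)?;
        (rule first.cu_rate_eq_iff second.cu_rate_eq_iff
          first.arg_max_device_limited second.arg_max_device_limited
          first.arg_max_user_limited[THEN conjunct1] first.arg_max_user_limited[THEN conjunct2]
          second.arg_max_user_limited[THEN conjunct1] second.arg_max_user_limited[THEN conjunct2];
          assumption)?)
      (simp_all add: slot_rate_eq[OF \<open>T > 0\<close>])
qed

end
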